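(* Let $X$ be a set and let $\mathcal{M}$ be a loc-lattice of subsets of $X$ which separates the points of $X$. (a) There exists a linear ordering $\le$ of $X$ such that every $M\in\mathcal{M}$ is a convex subset of $(X,\le)$. (b) If moreover the family $\mathcal{M}$ well separates $X$, then for every $A,B\in\mathcal{M}$ we have $A\vee B=\mathrm{co}(A\cup B)$, and so $(\mathcal{M},\subseteq)$ is a sublattice of $(\mathrm{Co}(X),\subseteq)$.
   Context: A family $\mathcal{M}$ of subsets of $X$ is a loc-lattice of sets (loc-lattice of subsets of $X$) if: (1) $(\mathcal{M},\subseteq)$ is a lattice, with join $A\vee B$ and meet $A\wedge B$; (2) $A\wedge B=A\cap B$ for all $A,B\in\mathcal{M}$; (3) if $A,B\in\mathcal{M}$ and $A\cap B\neq\emptyset$ then $A\vee B=A\cup B$; (4) for all $A,B,C\in\mathcal{M}$, $A\subseteq B\vee C$ or $B\subseteq A\vee C$ or $C\subseteq A\vee B$; (5) if $A,B,C\in\mathcal{M}$ are pairwise incomparable for $\subseteq$ and $B\subseteq A\vee C$, then $B=(A\vee B)\cap(C\vee B)$. $\mathcal{M}$ separates $X$ if for all distinct $x,y\in X$ there is $M\in\mathcal{M}$ containing exactly one of $x,y$. $\mathcal{M}$ well separates $X$ if for every $x\in X$ and every nonempty $M\in\mathcal{M}$ with $x\notin M$ there exists $N\in\mathcal{M}$ with $x\in N$ and $M\not\subseteq N$. For a linearly ordered set $(X,\le)$, $\mathrm{Co}(X)$ is the lattice of all convex subsets of $X$ (including $\emptyset$) ordered by inclusion, and $\mathrm{co}(A)$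 is the convex hull of $A\subseteq X$. In (b), the ordering is the one in (a), i.e. any linear ordering of $X$ for which all members of $\mathcal{M}$ are convex. *)

theory Defs
  imports "HOL-Algebra.Lattice" HOL.Hull
begin

definition incl_order :: "'a set set \<Rightarrow> 'a set gorder" where
  "incl_order \<M> = \<lparr>carrier = \<M>, eq = (=), le = (\<subseteq>)\<rparr>"

(* The join is the one of the poset (M, <=), not the union. *)
abbreviation set_join :: "'a set set \<Rightarrow> 'a set \<Rightarrow> 'a set \<Rightarrow> 'a set" where
  "set_join \<M> A B \<equiv> A \<squnion>\<^bsub>incl_order \<M>\<^esub> B"

abbreviation set_meet :: "'a set set \<Rightarrow> 'a set \<Rightarrow> 'a set \<Rightarrow> 'a set" where
  "set_meet \<M> A B \<equiv> A \<sqinter>\<^bsub>incl_order \<M>\<^esub> B"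

definition incomparable :: "'a set \<Rightarrow> 'a set \<Rightarrow> bool" where
  "incomparable A B \<longleftrightarrow> \<not> A \<subseteq> B \<and> \<not> B \<subseteq> A"

locale loc_lattice =
  fixes X :: "'a set" and \<M> :: "'a set set"
  assumes subsets: "\<M> \<subseteq> Pow X"
    and is_lattice: "lattice (incl_order \<M>)"
    and meet_eq: "\<lbrakk>A \<in> \<M>; B \<in> \<M>\<rbrakk> \<Longrightarrow> set_meet \<M> A B = A \<inter> B"
    and join_eq: "\<lbrakk>A \<in> \<M>; B \<in> \<M>; A \<inter> B \<noteq> {}\<rbrakk> \<Longrightarrow> set_join \<M> A B = A \<union> B"
    and one_below_join: "\<lbrakk>A \<in> \<M>; B \<in> \<M>; C \<in> \<M>\<rbrakk> \<Longrightarrow>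
      A \<subseteq> set_join \<M> B C \<or> B \<subseteq> set_join \<M> A C \<or> C \<subseteq> set_join \<M> A B"
    and between: "\<lbrakk>A \<in> \<M>; B \<in> \<M>; C \<in> \<M>;
      incomparable A B; incomparable A C; incomparable B C; B \<subseteq> set_join \<M> A C\<rbrakk> \<Longrightarrow>
      B = set_join \<M> A B \<inter> set_join \<M> C B"

definition separates :: "'a set set \<Rightarrow> 'a set \<Rightarrow> bool" where
  "separates \<M> X \<longleftrightarrow> (\<forall>x\<in>X. \<forall>y\<in>X. x \<noteq> y \<longrightarrow> (\<exists>M\<in>\<M>. (x \<in> M) \<noteq> (y \<in> M)))"

definition well_separates :: "'a set set \<Rightarrow> 'a set \<Rightarrow> bool" where
  "well_separates \<M> X \<longleftrightarrow>
    (\<forall>x\<in>X. \<forall>M\<in>\<M>. M \<noteq> {} \<and> x \<notin> M \<longrightarrow> (\<exists>N\<in>\<M>. x \<in> N \<and> \<not> M \<subseteq> N))"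

definition order_convex :: "'a set \<Rightarrow> 'a rel \<Rightarrow> 'a set \<Rightarrow> bool" where
  "order_convex X r C \<longleftrightarrow> C \<subseteq> X \<and>
    (\<forall>x\<in>C. \<forall>z\<in>C. \<forall>y\<in>X. (x, y) \<in> r \<and> (y, z) \<in> r \<longrightarrow> y \<in> C)"

definition Co :: "'a set \<Rightarrow> 'a rel \<Rightarrow> 'a set set" where
  "Co X r = {C. order_convex X r C}"

definition co :: "'a set \<Rightarrow> 'a rel \<Rightarrow> 'a set \<Rightarrow> 'a set" where
  "co X r A = order_convex X r hull A"

definition sublattice_of :: "'a gorder \<Rightarrow> 'a gorder \<Rightarrow> bool" where
  "sublattice_of K L \<longleftrightarrow> lattice K \<and> lattice L \<and> carrier K \<subseteq> carrier L \<and>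
    (\<forall>a\<in>carrier K. \<forall>b\<in>carrier K.
      (a \<sqsubseteq>\<^bsub>K\<^esub> b \<longleftrightarrow> a \<sqsubseteq>\<^bsub>L\<^esub> b) \<and>
      a \<squnion>\<^bsub>K\<^esub> b = a \<squnion>\<^bsub>L\<^esub> b \<and>
      a \<sqinter>\<^bsub>K\<^esub> b = a \<sqinter>\<^bsub>L\<^esub> b)"

end

theory Submission
  imports Defs "HOL-Analysis.Function_Topology"
begin

text \<open>
  The linear ordering comes from the members of a loc-lattice that meet each other.
  Two members that meet have their union as join, and for three pairwise overlapping members
  \<open>one_below_join\<close> and \<open>between\<close> say that one of them contains the
  intersection of the other two and is contained in their union, as for three overlapping
  intervals on a line. A family with these
  two properties is called \<open>interval_like\<close> below. The properties pass to traces on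
  any subset, which reduces the problem to finitely many points; joins in the lattice have no
  such traces.

  A finite \<open>interval_like\<close> family on \<open>Y\<close> is ordered one point at a
  time. A point \<open>e\<close> can be the first point of a convexity ordering only if the
  members that contain \<open>e\<close> form a chain, since they have to be initial segments. This
  condition is also enough: the point \<open>c\<close> that follows \<open>e\<close> has to lie in
  every member that contains \<open>e\<close> and another point, and it has to satisfy the same
  chain condition once \<open>e\<close> is deleted. An ordering of \<open>Y - {e}\<close> with
  first point \<open>c\<close> then extends by putting \<open>e\<close> below
  (\<open>finite_order_from_end\<close>). To find \<open>c\<close>, one looks for a block of points
  that no member cuts properly and whose members above form a chain (\<open>end_block\<close>);
  \<open>end_block_after_end\<close> finds such a block next to \<open>e\<close>, and
  \<open>end_block_has_end\<close> shrinks it to a point. For infinite families, Tychonoff's theorem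
  glues the orderings of the finite traces (\<open>relation_compactness\<close>).

  For the second claim, let every member be convex and let \<open>z\<close> lie in the join of
  \<open>A\<close> and \<open>B\<close>, but beyond their hull, say with \<open>B\<close> between
  \<open>A\<close> and \<open>z\<close>. Well-separation gives a member \<open>N\<close> that
  contains \<open>z\<close> but not all of \<open>B\<close>; by convexity \<open>N\<close> misses
  \<open>A\<close>. The three sets are pairwise incomparable, so that by \<open>one_below_join\<close> one lies in
  the join of the other two, and each of the three cases contradicts \<open>between\<close>
  (\<open>point_beyond_join\<close>).
\<close>

section \<open>Interval-like families\<close>

definition overlaps :: "'a set \<Rightarrow> 'a set \<Rightarrow> bool" where
  "overlaps A B \<longleftrightarrow> A \<inter> B \<noteq> {} \<and> incomparable A B"

definition middle :: "'a set \<Rightarrow> 'a set \<Rightarrow> 'a set \<Rightarrow> bool" where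
  "middle A B C \<longleftrightarrow> A \<inter> C \<subseteq> B \<and> B \<subseteq> A \<union> C"

definition interval_like :: "'a set set \<Rightarrow> bool" where
  "interval_like F \<longleftrightarrow>
    (\<forall>A\<in>F. \<forall>B\<in>F. A \<inter> B \<noteq> {} \<longrightarrow> A \<union> B \<in> F) \<and>
    (\<forall>A\<in>F. \<forall>B\<in>F. \<forall>C\<in>F. overlaps A B \<and> overlaps B C \<and> overlaps A C \<longrightarrow>
      middle A B C \<or> middle B A C \<or> middle A C B)"

lemma chain_subset_comparable:
  "\<lbrakk>chain_subset C; A \<in> C; B \<in> C\<rbrakk> \<Longrightarrow> A \<subseteq> B \<or> B \<subseteq> A"
  by (simp add: chain_subset_def)

lemma interval_like_union:
  "\<lbrakk>interval_like F; A \<in> F; B \<in> F; A \<inter> B \<noteq> {}\<rbrakk> \<Longrightarrow> A \<union> B \<in> F"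
  by (simp add: interval_like_def)

lemma interval_like_middle:
  "\<lbrakk>interval_like F; A \<in> F; B \<in> F; C \<in> F; overlaps A B; overlaps B C; overlaps A C\<rbrakk>
    \<Longrightarrow> middle A B C \<or> middle B A C \<or> middle A C B"
  unfolding interval_like_def by blast

text \<open>
  The form in which the condition on triples is used: when \<open>C\<close> is not the one in the
  middle, \<open>A\<close> and \<open>B\<close> reach into \<open>C\<close> from the same side, so
  that their traces on it are nested.
\<close>

lemma nested_in_third:
  assumes F: "interval_like F" "A \<in> F" "B \<in> F" "C \<in> F"
    and ov: "overlaps A C" "overlaps B C" and AB: "A \<inter> B \<noteq> {}"
    and out: "\<not> middle A C B"
  shows "A \<inter> C \<subseteq> B \<or> B \<inter> C \<subseteq> A"
proof (cases "incomparable A B")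
  case True
  then have "overlaps A B"
    using AB by (simp add: overlaps_def)
  then have "middle A B C \<or> middle B A C \<or> middle A C B"
    using interval_like_middle F ov by metis
  then show ?thesis
    using out by (auto simp: middle_def)
qed (auto simp: incomparable_def)

text \<open>
  Sets whose traces meet or are incomparable do so themselves, and unions, intersections and
  inclusions restrict to traces.
\<close>

lemma interval_like_trace:
  assumes F: "interval_like F"
  shows "interval_like ((\<lambda>M. M \<inter> Y) ` F)"
  unfolding interval_like_def
proof (intro conjI ballI impI)
  fix A B assume "A \<in> (\<lambda>M. M \<inter> Y) ` F" "B \<in> (\<lambda>M. M \<inter> Y) ` F" and ne: "A \<inter> B \<noteq> {}"
  then obtain A' B' where m: "A' \<in> F" "B' \<in> F" and eq: "A = A' \<inter> Y" "B = B' \<inter> Y"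
    by auto
  then have "A' \<union> B' \<in> F"
    using ne interval_like_union[OF F] by blast
  moreover have "A \<union> B = (A' \<union> B') \<inter> Y"
    using eq by blast
  ultimately show "A \<union> B \<in> (\<lambda>M. M \<inter> Y) ` F"
    by blast
next
  fix A B C
  assume "A \<in> (\<lambda>M. M \<inter> Y) ` F" "B \<in> (\<lambda>M. M \<inter> Y) ` F" "C \<in> (\<lambda>M. M \<inter> Y) ` F"
    and ov: "overlaps A B \<and> overlaps B C \<and> overlaps A C"
  then obtain A' B' C' where m: "A' \<in> F" "B' \<in> F" "C' \<in> F"
    and eq: "A = A' \<inter> Y" "B = B' \<inter> Y" "C = C' \<inter> Y"
    by auto
  have lift: "overlaps V W" if "overlaps (V \<inter> Y) (W \<inter> Y)" for V W
    using that unfolding overlaps_def incomparable_def by blast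
  have "middle A' B' C' \<or> middle B' A' C' \<or> middle A' C' B'"
    using interval_like_middle[OF F m] ov eq lift by simp
  then show "middle A B C \<or> middle B A C \<or> middle A C B"
    unfolding eq middle_def by blast
qed

section \<open>Points that can come first\<close>

text \<open>
  In a convexity ordering where the points of \<open>S\<close> come first, the members that
  contain \<open>S\<close> are initial segments, hence a chain. The middle condition says
  that no member overlaps \<open>S\<close>, so that \<open>S\<close> behaves like a single point
  towards all members that are not inside it. For \<open>S = {c}\<close> it is void, and what is
  left is the chain condition at \<open>c\<close>.
\<close>

definition end_block :: "'a set set \<Rightarrow> 'a set \<Rightarrow> bool" where
  "end_block F S \<longleftrightarrow> S \<noteq> {} \<and> (\<forall>M\<in>F. M \<inter> S = {} \<or> M \<subseteq> S \<or> S \<subseteq> M) \<and>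
    chain_subset {M \<in> F. S \<subseteq> M}"

text \<open>
  Members that leave \<open>S\<close> cannot tell a subset of \<open>S\<close> from \<open>S\<close>,
  so shrinking an end block only needs care for the members properly inside it.
\<close>

lemma end_block_sub:
  assumes S: "end_block F S" and S': "S' \<subset> S" "S' \<noteq> {}"
    and un: "\<And>M. \<lbrakk>M \<in> F; M \<subset> S; M \<inter> S' \<noteq> {}\<rbrakk> \<Longrightarrow> M \<subseteq> S' \<or> S' \<subseteq> M"
    and ch: "\<And>M N. \<lbrakk>M \<in> F; N \<in> F; M \<subset> S; N \<subset> S; S' \<subseteq> M; S' \<subseteq> N\<rbrakk>
      \<Longrightarrow> M \<subseteq> N \<or> N \<subseteq> M"
  shows "end_block F S'"
proof -
  have cmp: "M \<subset> S \<or> S \<subseteq> M" if "M \<in> F" "M \<inter> S' \<noteq> {}" for M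
    using S that S'(1) unfolding end_block_def by blast
  have "M \<inter> S' = {} \<or> M \<subseteq> S' \<or> S' \<subseteq> M" if "M \<in> F" for M
    using cmp[OF that] un[OF that] S'(1) by blast
  moreover have "M \<subseteq> N \<or> N \<subseteq> M" if "M \<in> F" "N \<in> F" "S' \<subseteq> M" "S' \<subseteq> N" for M N
  proof -
    have "M \<inter> S' \<noteq> {}" "N \<inter> S' \<noteq> {}"
      using that S'(2) by blast+
    then have "M \<subset> S \<or> S \<subseteq> M" "N \<subset> S \<or> S \<subseteq> N"
      using cmp that by simp_all
    then consider "M \<subset> S" "N \<subset> S" | "M \<subset> S" "S \<subseteq> N" | "S \<subseteq> M" "N \<subset> S" | "S \<subseteq> M" "S \<subseteq> N"
      by metis
    then show ?thesis
    proof cases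
      case 1 then show ?thesis using ch that by blast
    next
      case 4 then show ?thesis
        using S that by (simp add: end_block_def chain_subset_def)
    qed auto
  qed
  ultimately show ?thesis
    using S'(2) by (simp add: end_block_def chain_subset_def)
qed

text \<open>
  Let \<open>B\<close> be a maximal member properly inside \<open>S\<close>. A member inside
  \<open>S\<close> that sticks out of \<open>B\<close> but meets it joins with \<open>B\<close> to
  a larger member, which must be all of \<open>S\<close>. So no member cuts \<open>S - B\<close>,
  and \<open>S - B\<close> can be put at the end.
\<close>

lemma end_block_shrink:
  assumes F: "interval_like F" and fin: "finite S" and S: "end_block F S"
    and big: "\<And>c. S \<noteq> {c}"
  shows "\<exists>S'\<subset>S. end_block F S'"
proof -
  define Q where "Q = {M \<in> F. M \<noteq> {} \<and> M \<subset> S}"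
  have finQ: "finite Q"
    by (rule finite_subset[of _ "Pow S"]) (auto simp: Q_def fin)
  show ?thesis
  proof (cases "Q = {}")
    case True
    obtain c where "c \<in> S"
      using S by (auto simp: end_block_def)
    then have "{c} \<subset> S"
      using big by auto
    moreover have "end_block F {c}"
      using end_block_sub[OF S \<open>{c} \<subset> S\<close>] True unfolding Q_def by blast
    ultimately show ?thesis
      by blast
  next
    case False
    then obtain B where B: "B \<in> Q" and Bmax: "\<And>M. M \<in> Q \<Longrightarrow> B \<subseteq> M \<Longrightarrow> M = B"
      using finite_has_maximal[OF finQ] by metis
    have BS: "B \<in> F" "B \<noteq> {}" "B \<subset> S"
      using B by (auto simp: Q_def)
    have cover: "M \<union> B = S" if "M \<in> F" "M \<subset> S" "M \<inter> B \<noteq> {}" "\<not> M \<subseteq> B" for M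
    proof (rule ccontr)
      assume "M \<union> B \<noteq> S"
      then have "M \<union> B \<in> Q"
        using that BS interval_like_union[OF F, of M B] unfolding Q_def by blast
      then show False
        using Bmax[of "M \<union> B"] that by blast
    qed
    have "end_block F (S - B)"
    proof (rule end_block_sub[OF S])
      show "S - B \<subset> S" "S - B \<noteq> {}"
        using BS by auto
    next
      fix M assume "M \<in> F" "M \<subset> S" "M \<inter> (S - B) \<noteq> {}"
      then show "M \<subseteq> S - B \<or> S - B \<subseteq> M"
        using cover[of M] by blast
    next
      fix M N assume M: "M \<in> F" "M \<subset> S" "S - B \<subseteq> M" and N: "N \<in> F" "N \<subset> S" "S - B \<subseteq> N"
      show "M \<subseteq> N \<or> N \<subseteq> M"
      proof (cases "M \<inter> B = {} \<or> N \<inter> B = {}")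
        case True
        then show ?thesis using M N by blast
      next
        case False
        obtain s where s: "s \<in> S" "s \<notin> B"
          using BS by blast
        then have sMN: "s \<in> M" "s \<in> N"
          using M N by auto
        \<comment> \<open>Both contain the points outside \<open>B\<close>, so \<open>B\<close> is not in the middle and it suffices to compare inside \<open>B\<close>.\<close>
        have "\<not> B \<subseteq> M" "\<not> B \<subseteq> N"
          using M N by blast+
        then have "overlaps M B" "overlaps N B"
          using False s sMN unfolding overlaps_def incomparable_def by blast+
        moreover have "M \<inter> N \<noteq> {}" "\<not> M \<inter> N \<subseteq> B"
          using s sMN by blast+
        ultimately have "M \<inter> B \<subseteq> N \<or> N \<inter> B \<subseteq> M"
          using nested_in_third[OF F M(1) N(1) BS(1)] unfolding middle_def by blast
        then show ?thesis
          using M N by blast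
      qed
    qed
    then show ?thesis
      using BS by blast
  qed
qed

lemma end_block_has_end:
  assumes F: "interval_like F" and fin: "finite S" and S: "end_block F S"
  shows "\<exists>c\<in>S. chain_subset {M \<in> F. c \<in> M}"
  using fin S
proof (induction S rule: finite_psubset_induct)
  case (psubset S)
  show ?case
  proof (cases "\<exists>c. S = {c}")
    case True
    then show ?thesis
      using psubset.prems by (auto simp: end_block_def)
  next
    case False
    then obtain S' where "S' \<subset> S" "end_block F S'"
      using end_block_shrink[OF F psubset.hyps psubset.prems] by metis
    then obtain c where "c \<in> S'" "chain_subset {M \<in> F. c \<in> M}"
      using psubset.IH by metis
    then show ?thesis
      using \<open>S' \<subset> S\<close> by blast
  qed
qed

section \<open>The point next to an end\<close>

text \<open>
  Let \<open>P\<close> be the least member that contains the end \<open>e\<close> and another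
  point, and let \<open>R = P - {e}\<close>; the next point must lie in \<open>R\<close>. A member
  containing \<open>R\<close> can be enlarged by \<open>e\<close>, so these members form a chain
  up to \<open>e\<close>. Only members that avoid \<open>e\<close> and overlap \<open>R\<close>
  can prevent \<open>R\<close> from being an end block. They all leave \<open>R\<close> on the
  side away from \<open>e\<close>; removing a maximal one, \<open>K\<close>, from \<open>R\<close>
  leaves the part adjacent to \<open>e\<close>.
\<close>

lemma end_block_after_end:
  assumes F: "interval_like F" and fin: "finite Y" and sub: "F \<subseteq> Pow Y"
    and YF: "Y \<in> F"
    and e: "e \<in> Y" "Y \<noteq> {e}" and ch: "chain_subset {M \<in> F. e \<in> M}"
  obtains S where "S \<subseteq> Y - {e}" "end_block ((\<lambda>M. M - {e}) ` F) S"
    "\<And>M. \<lbrakk>M \<in> F; e \<in> M; M \<noteq> {e}\<rbrakk> \<Longrightarrow> S \<subseteq> M"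
proof -
  define Q where "Q = {M \<in> F. e \<in> M \<and> M \<noteq> {e}}"
  have finF: "finite F"
    using fin sub by (meson finite_Pow_iff finite_subset)
  have "finite Q" "Y \<in> Q"
    using finF YF e by (auto simp: Q_def)
  then obtain P where P: "P \<in> Q" and Pmin: "\<And>M. M \<in> Q \<Longrightarrow> M \<subseteq> P \<Longrightarrow> M = P"
    using finite_has_minimal[of Q] by (metis empty_iff)
  have PF: "P \<in> F" "e \<in> P" "P \<noteq> {e}"
    using P by (auto simp: Q_def)
  have PM: "P \<subseteq> M" if "M \<in> F" "e \<in> M" "M \<noteq> {e}" for M
    using Pmin[of M] that PF ch unfolding Q_def chain_subset_def by blast
  define R where "R = P - {e}"
  have Rne: "R \<noteq> {}"
    using PF by (auto simp: R_def)
  have RY: "R \<subseteq> Y - {e}"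
    using PF sub by (auto simp: R_def)
  have RM: "R \<subseteq> M" if "M \<in> F" "e \<in> M" "M \<noteq> {e}" for M
    using PM[OF that] by (auto simp: R_def)
  have over: "M \<union> {e} \<in> F" if "M \<in> F" "R \<subseteq> M" for M
  proof -
    have "M \<union> P \<in> F"
      using that PF Rne interval_like_union[OF F that(1) PF(1)] by (auto simp: R_def)
    moreover have "M \<union> P = M \<union> {e}"
      using that PF by (auto simp: R_def)
    ultimately show ?thesis by simp
  qed
  have above: "M - {e} \<subseteq> N - {e} \<or> N - {e} \<subseteq> M - {e}"
    if "M \<in> F" "R \<subseteq> M" "N \<in> F" "R \<subseteq> N" for M N
  proof -
    have "M \<union> {e} \<in> {M \<in> F. e \<in> M}" "N \<union> {e} \<in> {M \<in> F. e \<in> M}"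
      using over that by simp_all
    then have "M \<union> {e} \<subseteq> N \<union> {e} \<or> N \<union> {e} \<subseteq> M \<union> {e}"
      by (rule chain_subset_comparable[OF ch])
    then show ?thesis by blast
  qed
  \<comment> \<open>Members containing \<open>e\<close> or \<open>R\<close> are now under control, so only the others remain to be checked for a block inside \<open>R\<close>.\<close>
  have block: "end_block ((\<lambda>M. M - {e}) ` F) S"
    if S: "S \<subseteq> R" "S \<noteq> {}"
      and un: "\<And>M. \<lbrakk>M \<in> F; e \<notin> M; M \<inter> S \<noteq> {}; \<not> R \<subseteq> M\<rbrakk> \<Longrightarrow> M \<subseteq> R \<and> (M \<subseteq> S \<or> S \<subseteq> M)"
      and cc: "\<And>M N. \<lbrakk>M \<in> F; N \<in> F; M \<subseteq> R; N \<subseteq> R; S \<subseteq> M; S \<subseteq> N\<rbrakk> \<Longrightarrow> M \<subseteq> N \<or> N \<subseteq> M"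
    for S
  proof -
    have eS: "e \<notin> S"
      using S by (auto simp: R_def)
    have cmp: "R \<subseteq> M \<or> e \<notin> M \<and> M \<subseteq> R \<and> (M \<subseteq> S \<or> S \<subseteq> M)" if "M \<in> F" "M \<inter> S \<noteq> {}" for M
    proof (cases "e \<in> M")
      case True
      then show ?thesis using RM[OF that(1)] that(2) eS by blast
    next
      case False
      then show ?thesis using un that by blast
    qed
    have 1: "(M - {e}) \<inter> S = {} \<or> M - {e} \<subseteq> S \<or> S \<subseteq> M - {e}" if "M \<in> F" for M
      using cmp[OF that] S(1) eS by blast
    have 2: "M - {e} \<subseteq> N - {e} \<or> N - {e} \<subseteq> M - {e}"
      if "M \<in> F" "N \<in> F" "S \<subseteq> M" "S \<subseteq> N" for M N
    proof -
      have "R \<subseteq> M \<or> M \<subseteq> R" "R \<subseteq> N \<or> N \<subseteq> R"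
        using cmp that S(2) by blast+
      then show ?thesis
        using above[OF that(1) _ that(2)] cc[OF that(1,2) _ _ that(3,4)] by blast
    qed
    have "chain_subset {M \<in> (\<lambda>M. M - {e}) ` F. S \<subseteq> M}"
      unfolding chain_subset_def
    proof (intro ballI)
      fix A B
      assume "A \<in> {M \<in> (\<lambda>M. M - {e}) ` F. S \<subseteq> M}" "B \<in> {M \<in> (\<lambda>M. M - {e}) ` F. S \<subseteq> M}"
      then obtain M N where "M \<in> F" "N \<in> F" "A = M - {e}" "B = N - {e}"
        and "S \<subseteq> M - {e}" "S \<subseteq> N - {e}"
        by auto
      then show "A \<subseteq> B \<or> B \<subseteq> A"
        using 2[of M N] by (simp add: subset_Diff_insert)
    qed
    then show ?thesis
      using S(2) 1 by (simp add: end_block_def)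
  qed
  show thesis
  proof (cases "\<exists>K\<in>F. e \<notin> K \<and> overlaps K R")
    case False
    have "end_block ((\<lambda>M. M - {e}) ` F) R"
    proof (rule block)
      fix M assume "M \<in> F" "e \<notin> M" "M \<inter> R \<noteq> {}" "\<not> R \<subseteq> M"
      then show "M \<subseteq> R \<and> (M \<subseteq> R \<or> R \<subseteq> M)"
        using False unfolding overlaps_def incomparable_def by blast
    qed (use Rne in auto)
    then show ?thesis
      using that RY RM by metis
  next
    case True
    define Over where "Over = {K \<in> F. e \<notin> K \<and> overlaps K R}"
    have "finite Over" "Over \<noteq> {}"
      using finF True by (auto simp: Over_def)
    then obtain K where K: "K \<in> Over" and Kmax: "\<And>M. M \<in> Over \<Longrightarrow> K \<subseteq> M \<Longrightarrow> M = K"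
      using finite_has_maximal by metis
    have KF: "K \<in> F" "e \<notin> K" and KR: "K \<inter> R \<noteq> {}" "\<not> K \<subseteq> R" "\<not> R \<subseteq> K"
      using K by (auto simp: Over_def overlaps_def incomparable_def)
    have ovP: "overlaps M P" if "e \<notin> M" "overlaps M R" for M
      using that PF unfolding overlaps_def incomparable_def R_def by blast
    \<comment> \<open>\<open>M \<union> P\<close> and \<open>K \<union> P\<close> contain \<open>e\<close>, hence are nested; so \<open>M\<close> and \<open>K\<close> leave \<open>R\<close> on the same side.\<close>
    have meetK: "M \<inter> K \<noteq> {}" if M: "M \<in> F" "e \<notin> M" "overlaps M R" for M
    proof -
      have "M \<inter> P \<noteq> {}" "K \<inter> P \<noteq> {}"
        using M(3) KR(1) unfolding R_def overlaps_def by blast+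
      then have "M \<union> P \<in> {M \<in> F. e \<in> M}" "K \<union> P \<in> {M \<in> F. e \<in> M}"
        using interval_like_union[OF F] M(1) KF(1) PF(1,2) by simp_all
      then have "M \<union> P \<subseteq> K \<union> P \<or> K \<union> P \<subseteq> M \<union> P"
        by (rule chain_subset_comparable[OF ch])
      then show ?thesis
        using M KR KF unfolding R_def overlaps_def incomparable_def by blast
    qed
    \<comment> \<open>The point \<open>e\<close> keeps \<open>P\<close> from being in the middle of \<open>M\<close> and \<open>K\<close>, so their traces on it are nested; then \<open>M \<union> K\<close> still overlaps \<open>R\<close>, against the maximality of \<open>K\<close>.\<close>
    have noov: "\<not> overlaps M R" if M: "M \<in> F" "e \<notin> M" "M \<inter> (R - K) \<noteq> {}" for M
    proof
      assume ov: "overlaps M R"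
      have "\<not> middle M P K"
        using M KF PF unfolding middle_def by blast
      then have "M \<inter> P \<subseteq> K \<or> K \<inter> P \<subseteq> M"
        using nested_in_third[OF F M(1) KF(1) PF(1)] ovP meetK[OF M(1,2) ov] M ov K KF
        by (auto simp: Over_def)
      then have KM: "K \<inter> R \<subseteq> M"
        using M unfolding R_def by blast
      have "M \<union> K \<in> F"
        using interval_like_union[OF F M(1) KF(1)] meetK[OF M(1,2) ov] by blast
      moreover have "overlaps (M \<union> K) R"
        using KM ov KR unfolding overlaps_def incomparable_def by blast
      ultimately have "M \<union> K \<in> Over"
        using M KF by (simp add: Over_def)
      then show False
        using Kmax[of "M \<union> K"] M by blast
    qed
    have "end_block ((\<lambda>M. M - {e}) ` F) (R - K)"
    proof (rule block)
      fix M assume M: "M \<in> F" "e \<notin> M" "M \<inter> (R - K) \<noteq> {}" "\<not> R \<subseteq> M"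
      then have MR: "M \<subseteq> R"
        using noov[of M] unfolding overlaps_def incomparable_def by blast
      have "R - K \<subseteq> M" if "M \<inter> K \<noteq> {}"
      proof (rule ccontr)
        assume n: "\<not> R - K \<subseteq> M"
        have "M \<union> K \<in> F"
          using interval_like_union[OF F M(1) KF(1)] that by blast
        moreover have "overlaps (M \<union> K) R"
          using n KR unfolding overlaps_def incomparable_def by blast
        ultimately have "M \<union> K \<in> Over"
          using M KF by (simp add: Over_def)
        then show False
          using Kmax[of "M \<union> K"] M by blast
      qed
      then show "M \<subseteq> R \<and> (M \<subseteq> R - K \<or> R - K \<subseteq> M)"
        using MR by blast
    next
      fix M N assume M: "M \<in> F" "M \<subseteq> R" "R - K \<subseteq> M" and N: "N \<in> F" "N \<subseteq> R" "R - K \<subseteq> N"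
      show "M \<subseteq> N \<or> N \<subseteq> M"
      proof (cases "M \<inter> K = {} \<or> N \<inter> K = {}")
        case True
        then show ?thesis using M N by blast
      next
        case False
        obtain s where s: "s \<in> R" "s \<notin> K"
          using KR by blast
        then have sMN: "s \<in> M" "s \<in> N"
          using M N by auto
        \<comment> \<open>\<open>K\<close> is not in the middle, because it has points outside \<open>R\<close>.\<close>
        have "\<not> K \<subseteq> M" "\<not> K \<subseteq> N" "\<not> K \<subseteq> M \<union> N"
          using M N KR by blast+
        then have "overlaps M K" "overlaps N K" "M \<inter> N \<noteq> {}" "\<not> middle M K N"
          using False s sMN unfolding overlaps_def incomparable_def middle_def by blast+
        then have "M \<inter> K \<subseteq> N \<or> N \<inter> K \<subseteq> M"
          using nested_in_third[OF F M(1) N(1) KF(1)] by blast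
        then show ?thesis
          using M N by blast
      qed
    qed (use KR in auto)
    moreover have "R - K \<subseteq> Y - {e}"
      using RY by blast
    moreover have "R - K \<subseteq> M" if "M \<in> F" "e \<in> M" "M \<noteq> {e}" for M
      using RM[OF that] by blast
    ultimately show ?thesis
      using that by metis
  qed
qed

section \<open>Orderings of finite families\<close>

text \<open>Adding \<open>Y\<close> guarantees that a least member around an end exists.\<close>

lemma interval_like_insert_top:
  assumes F: "interval_like F" and sub: "F \<subseteq> Pow Y"
  shows "interval_like (insert Y F)"
proof -
  have top: "\<not> overlaps A Y" "\<not> overlaps Y A" "A \<union> Y = Y" "Y \<union> A = Y" if "A \<in> insert Y F" for A
    using that sub by (auto simp: overlaps_def incomparable_def)
  show ?thesis
    unfolding interval_like_def
  proof (intro conjI ballI impI)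
    fix A B assume "A \<in> insert Y F" "B \<in> insert Y F" "A \<inter> B \<noteq> {}"
    then show "A \<union> B \<in> insert Y F"
      using top interval_like_union[OF F, of A B] by auto
  next
    fix A B C
    assume m: "A \<in> insert Y F" "B \<in> insert Y F" "C \<in> insert Y F"
      and ov: "overlaps A B \<and> overlaps B C \<and> overlaps A C"
    then have "A \<in> F" "B \<in> F" "C \<in> F"
      by (metis insertE top(1,2))+
    then show "middle A B C \<or> middle B A C \<or> middle A C B"
      using interval_like_middle[OF F] ov by simp
  qed
qed

lemma linear_order_on_insert_least:
  assumes r: "linear_order_on (Y - {e}) r" and e: "e \<in> Y"
  shows "linear_order_on Y (r \<union> {e} \<times> Y)"
  using assms unfolding order_on_defs refl_on_def trans_def antisym_def total_on_def
  by blast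

text \<open>
  A convex set that contains the least point \<open>c\<close> is an initial segment, so a new least
  point can be added to it. A convex set that does not get the new point stays convex.
\<close>

lemma order_convex_insert_least:
  assumes M: "M \<subseteq> Y" and e: "e \<in> Y" and r: "r \<subseteq> (Y - {e}) \<times> (Y - {e})"
    and conv: "order_convex (Y - {e}) r (M - {e})"
    and least: "\<And>y. y \<in> Y - {e} \<Longrightarrow> (c, y) \<in> r"
    and c: "e \<in> M \<Longrightarrow> M \<noteq> {e} \<Longrightarrow> c \<in> M - {e}"
  shows "order_convex Y (r \<union> {e} \<times> Y) M"
  unfolding order_convex_def
proof (intro conjI ballI impI)
  fix x z y assume m: "x \<in> M" "z \<in> M" "y \<in> Y"
    and b: "(x, y) \<in> r \<union> {e} \<times> Y \<and> (y, z) \<in> r \<union> {e} \<times> Y"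
  have between: "y \<in> M" if "u \<in> M - {e}" "(u, y) \<in> r" "(y, z) \<in> r" for u
    using conv that m r unfolding order_convex_def by blast
  show "y \<in> M"
  proof (cases "y = e")
    case True
    then show ?thesis using b m r by auto
  next
    case False
    then have yz: "(y, z) \<in> r" "z \<noteq> e"
      using b r by auto
    show ?thesis
    proof (cases "x = e")
      case True
      then have "c \<in> M - {e}"
        using c m yz by blast
      then show ?thesis
        using between least yz False m by blast
    next
      case ne: False
      then show ?thesis
        using between[of x] b yz m by blast
    qed
  qed
qed (rule M)

lemma finite_order_from_end:
  assumes "finite Y" "interval_like F" "F \<subseteq> Pow Y" "e \<in> Y" "chain_subset {M \<in> F. e \<in> M}"
  shows "\<exists>r. linear_order_on Y r \<and> (\<forall>y\<in>Y. (e, y) \<in> r) \<and> (\<forall>M\<in>F. order_convex Y r M)"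
  using assms
proof (induction Y arbitrary: F e rule: finite_psubset_induct)
  case (psubset Y)
  note sub = \<open>F \<subseteq> Pow Y\<close> and e = \<open>e \<in> Y\<close>
  show ?case
  proof (cases "Y = {e}")
    case True
    then show ?thesis
      using sub by (intro exI[of _ "{(e, e)}"]) (auto simp: order_convex_def)
  next
    case False
    let ?F = "insert Y F"
    have chY: "chain_subset {M \<in> ?F. e \<in> M}"
      using psubset.prems(4) sub by (auto simp: chain_subset_def)
    have F: "interval_like ?F"
      using psubset.prems interval_like_insert_top by blast
    obtain S where S: "S \<subseteq> Y - {e}" "end_block ((\<lambda>M. M - {e}) ` ?F) S"
      and low: "\<And>M. \<lbrakk>M \<in> ?F; e \<in> M; M \<noteq> {e}\<rbrakk> \<Longrightarrow> S \<subseteq> M"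
      using end_block_after_end[OF F psubset.hyps _ _ e False chY] sub by blast
    have G: "interval_like ((\<lambda>M. M - {e}) ` ?F)"
      using interval_like_trace[OF F, of "- {e}"] by (simp add: Diff_eq)
    obtain c where c: "c \<in> S" "chain_subset {M \<in> (\<lambda>M. M - {e}) ` ?F. c \<in> M}"
      using end_block_has_end[OF G _ S(2)] S(1) psubset.hyps finite_subset by (metis finite_Diff)
    have smaller: "Y - {e} \<subset> Y" "(\<lambda>M. M - {e}) ` ?F \<subseteq> Pow (Y - {e})" "c \<in> Y - {e}"
      using e sub c(1) S(1) by auto
    obtain r where r: "linear_order_on (Y - {e}) r" "\<forall>y\<in>Y - {e}. (c, y) \<in> r"
      "\<forall>M\<in>(\<lambda>M. M - {e}) ` ?F. order_convex (Y - {e}) r M"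
      using psubset.IH[OF smaller(1) G smaller(2,3) c(2)] by (elim exE conjE)
    have "order_convex Y (r \<union> {e} \<times> Y) M" if "M \<in> F" for M
    proof (rule order_convex_insert_least[where c = c])
      show "r \<subseteq> (Y - {e}) \<times> (Y - {e})"
        using r(1) by (simp add: order_on_defs)
      show "c \<in> M - {e}" if "e \<in> M" "M \<noteq> {e}"
        using low[of M] \<open>M \<in> F\<close> that c(1) S(1) by blast
    qed (use that sub e r in auto)
    then show ?thesis
      using linear_order_on_insert_least[OF r(1) e] by blast
  qed
qed

text \<open>The whole set is an end block, so a first point always exists.\<close>

lemma interval_like_finite_order:
  assumes fin: "finite Y" and F: "interval_like F" and sub: "F \<subseteq> Pow Y"
  shows "\<exists>r. linear_order_on Y r \<and> (\<forall>M\<in>F. order_convex Y r M)"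
proof (cases "Y = {}")
  case True
  then show ?thesis
    using sub by (intro exI[of _ "{}"]) (auto simp: order_convex_def)
next
  case False
  have "end_block F Y"
    using False sub by (auto simp: end_block_def chain_subset_def)
  then obtain c where "c \<in> Y" "chain_subset {M \<in> F. c \<in> M}"
    using end_block_has_end[OF F fin] by blast
  then show ?thesis
    using finite_order_from_end[OF fin F sub] by blast
qed

section \<open>Infinite families\<close>

text \<open>
  The relations form the compact product space of copies of the discrete two-point space, and by
  \<open>loc\<close> the condition for a finite \<open>Y\<close> depends on finitely many
  coordinates, so that it defines a closed set. By \<open>ex\<close> and \<open>mono\<close>,
  finitely many of these sets have a common element.
\<close>

lemma relation_compactness:
  fixes P :: "'a set \<Rightarrow> 'a rel \<Rightarrow> bool"
  assumes ex: "\<And>Y. finite Y \<Longrightarrow> \<exists>r. P Y r"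
    and mono: "\<And>Y Z r. \<lbrakk>P Y r; Z \<subseteq> Y\<rbrakk> \<Longrightarrow> P Z r"
    and loc: "\<And>Y r s. \<lbrakk>P Y r; r \<inter> Y \<times> Y = s \<inter> Y \<times> Y\<rbrakk> \<Longrightarrow> P Y s"
  shows "\<exists>r. \<forall>Y. finite Y \<longrightarrow> P Y r"
proof -
  let ?T = "product_topology (\<lambda>_. discrete_topology UNIV) UNIV :: ('a \<times> 'a \<Rightarrow> bool) topology"
  define C where "C Y = {f. P Y {p. f p}}" for Y :: "'a set"
  have top: "topspace ?T = UNIV"
    by simp
  have comp: "compact_space ?T"
    by (simp add: compact_space_product_topology compact_space_discrete_topology)
  have closed: "closedin ?T (C Y)" if fin: "finite Y" for Y
  proof -
    have "openin ?T (- C Y)"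
      unfolding openin_product_topology_alt
    proof
      fix f assume f: "f \<in> - C Y"
      \<comment> \<open>The basic neighbourhood of \<open>f\<close> that fixes the coordinates in \<open>Y \<times> Y\<close>.\<close>
      define U where "U p = (if p \<in> Y \<times> Y then {f p} else UNIV)" for p
      have "{p. U p \<noteq> UNIV} \<subseteq> Y \<times> Y"
        by (auto simp: U_def split: if_splits)
      then have "finite {p. U p \<noteq> UNIV}"
        using fin finite_subset by blast
      moreover have "f \<in> PiE UNIV U"
        by (auto simp: U_def)
      moreover have "PiE UNIV U \<subseteq> - C Y"
      proof
        fix g assume g: "g \<in> PiE UNIV U"
        have "g p = f p" if "p \<in> Y \<times> Y" for p
        proof -
          have "g p \<in> U p"
            using g by (rule PiE_mem) simp
          then show ?thesis
            using that by (simp add: U_def)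
        qed
        then have "{p. g p} \<inter> Y \<times> Y = {p. f p} \<inter> Y \<times> Y"
          by auto
        then show "g \<in> - C Y"
          using f loc unfolding C_def by blast
      qed
      ultimately show "\<exists>U. finite {p \<in> UNIV. U p \<noteq> topspace (discrete_topology UNIV)} \<and>
          (\<forall>p\<in>UNIV. openin (discrete_topology UNIV) (U p)) \<and> f \<in> PiE UNIV U \<and> PiE UNIV U \<subseteq> - C Y"
        by (intro exI[of _ U]) auto
    qed
    then show ?thesis
      by (simp add: closedin_def top Compl_eq_Diff_UNIV)
  qed
  have "\<Inter>(C ` {Y. finite Y}) \<noteq> {}"
  proof (rule comp[unfolded compact_space_fip, rule_format], intro conjI ballI allI impI)
    fix K assume "K \<in> C ` {Y. finite Y}"
    then show "closedin ?T K"
      using closed by blast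
  next
    fix \<K> assume "finite \<K> \<and> \<K> \<subseteq> C ` {Y. finite Y}"
    then obtain I where I: "finite I" "I \<subseteq> {Y. finite Y}" "\<K> = C ` I"
      by (meson finite_subset_image)
    then obtain r where r: "P (\<Union>I) r"
      using ex[of "\<Union>I"] by blast
    have "(\<lambda>p. p \<in> r) \<in> C Y" if "Y \<in> I" for Y
      using mono[OF r] that unfolding C_def by auto
    then show "\<Inter>\<K> \<noteq> {}"
      using I(3) by blast
  qed
  then obtain f where "\<And>Y. finite Y \<Longrightarrow> f \<in> C Y"
    by blast
  then show ?thesis
    unfolding C_def by blast
qed

lemma linear_order_on_restrict:
  assumes "linear_order_on Y r" "Z \<subseteq> Y"
  shows "linear_order_on Z (r \<inter> Z \<times> Z)"
  using assms unfolding order_on_defs refl_on_def trans_def antisym_def total_on_def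
  by blast

lemma order_convex_restrict:
  assumes "order_convex Y r M" "Z \<subseteq> Y"
  shows "order_convex Z (r \<inter> Z \<times> Z) (M \<inter> Z)"
  using assms unfolding order_convex_def by blast

text \<open>
  The order axioms and convexity speak of at most three points at a time, so a relation that is
  right on every finite set is right.
\<close>

lemma interval_like_order:
  assumes F: "interval_like F"
  shows "\<exists>r. linear_order_on UNIV r \<and> (\<forall>M\<in>F. order_convex UNIV r M)"
proof -
  define P where "P Y r \<longleftrightarrow> linear_order_on Y (r \<inter> Y \<times> Y) \<and>
    (\<forall>M\<in>F. order_convex Y (r \<inter> Y \<times> Y) (M \<inter> Y))" for Y r
  have "\<exists>r. \<forall>Y. finite Y \<longrightarrow> P Y r"
  proof (rule relation_compactness)
    fix Y :: "'a set" assume "finite Y"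
    then obtain r where r: "linear_order_on Y r" "\<forall>M\<in>(\<lambda>M. M \<inter> Y) ` F. order_convex Y r M"
      using interval_like_finite_order[OF _ interval_like_trace[OF F, of Y]] by blast
    moreover have "r \<inter> Y \<times> Y = r"
      using r(1) by (auto simp: order_on_defs)
    ultimately show "\<exists>r. P Y r"
      unfolding P_def by (intro exI[of _ r]) simp
  next
    fix Y Z :: "'a set" and r assume P: "P Y r" and Z: "Z \<subseteq> Y"
    have eq: "r \<inter> Y \<times> Y \<inter> Z \<times> Z = r \<inter> Z \<times> Z" "\<And>M. M \<inter> Y \<inter> Z = M \<inter> Z"
      using Z by auto
    show "P Z r"
      using P linear_order_on_restrict[OF _ Z, of "r \<inter> Y \<times> Y"]
        order_convex_restrict[OF _ Z, of "r \<inter> Y \<times> Y"]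
      unfolding P_def by (metis eq)
  next
    fix Y :: "'a set" and r s assume "P Y r" "r \<inter> Y \<times> Y = s \<inter> Y \<times> Y"
    then show "P Y s"
      by (simp add: P_def)
  qed
  then obtain r where r: "\<And>Y. finite Y \<Longrightarrow> P Y r"
    by blast
  have three: "linear_order_on {x, y, z} (r \<inter> {x, y, z} \<times> {x, y, z})" for x y z
    using r[of "{x, y, z}"] by (simp add: P_def)
  have "linear_order_on UNIV r"
    unfolding order_on_defs refl_on_def
  proof (intro conjI ballI)
    show "(x, x) \<in> r" for x
      using three[of x x x] by (simp add: order_on_defs refl_on_def)
    show "trans r"
    proof (rule transI)
      fix x y z assume "(x, y) \<in> r" "(y, z) \<in> r"
      then show "(x, z) \<in> r"
        using three[of x y z] unfolding order_on_defs trans_def by blast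
    qed
    show "antisym r"
    proof (rule antisymI)
      fix x y assume "(x, y) \<in> r" "(y, x) \<in> r"
      then show "x = y"
        using three[of x y y] unfolding order_on_defs antisym_def by blast
    qed
    show "total_on UNIV r"
      unfolding total_on_def
    proof (intro ballI impI)
      fix x y :: 'a assume "x \<noteq> y"
      then show "(x, y) \<in> r \<or> (y, x) \<in> r"
        using three[of x y y] unfolding order_on_defs total_on_def by blast
    qed
  qed simp
  moreover have "order_convex UNIV r M" if "M \<in> F" for M
    unfolding order_convex_def
  proof (intro conjI ballI impI)
    fix x z y assume "x \<in> M" "z \<in> M" "(x, y) \<in> r \<and> (y, z) \<in> r"
    moreover have "order_convex {x, y, z} (r \<inter> {x, y, z} \<times> {x, y, z}) (M \<inter> {x, y, z})"
      using r[of "{x, y, z}"] that by (simp add: P_def)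
    ultimately show "y \<in> M"
      unfolding order_convex_def by blast
  qed simp
  ultimately show ?thesis
    by blast
qed

section \<open>Loc-lattices\<close>

lemma incl_order_simps [simp]:
  "carrier (incl_order \<M>) = \<M>" "eq (incl_order \<M>) = (=)" "le (incl_order \<M>) = (\<subseteq>)"
  by (simp_all add: incl_order_def)

lemma incl_order_partial_order: "partial_order (incl_order \<M>)"
  by unfold_locales auto

lemma least_upperI:
  assumes "A \<in> \<M>" "B \<in> \<M>" "J \<in> \<M>" "A \<subseteq> J" "B \<subseteq> J"
    and "\<And>C. \<lbrakk>C \<in> \<M>; A \<subseteq> C; B \<subseteq> C\<rbrakk> \<Longrightarrow> J \<subseteq> C"
  shows "least (incl_order \<M>) J (Upper (incl_order \<M>) {A, B})"
  using assms by (auto simp: least_def Upper_def)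

lemma greatest_lowerI:
  assumes "A \<in> \<M>" "B \<in> \<M>" "A \<inter> B \<in> \<M>"
  shows "greatest (incl_order \<M>) (A \<inter> B) (Lower (incl_order \<M>) {A, B})"
  using assms by (auto simp: greatest_def Lower_def)

context loc_lattice
begin

interpretation L: lattice "incl_order \<M>"
  by (rule is_lattice)

lemma join_upper:
  assumes "A \<in> \<M>" "B \<in> \<M>"
  shows "set_join \<M> A B \<in> \<M>" "A \<subseteq> set_join \<M> A B" "B \<subseteq> set_join \<M> A B"
  using L.join_closed[of A B] L.join_left[of A B] L.join_right[of A B] assms by simp_all

lemma join_least:
  "\<lbrakk>A \<in> \<M>; B \<in> \<M>; C \<in> \<M>; A \<subseteq> C; B \<subseteq> C\<rbrakk> \<Longrightarrow> set_join \<M> A B \<subseteq> C"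
  using L.join_le[of A C B] by simp

lemma join_commute: "\<lbrakk>A \<in> \<M>; B \<in> \<M>\<rbrakk> \<Longrightarrow> set_join \<M> A B = set_join \<M> B A"
  by (intro subset_antisym join_least join_upper)

lemma middle_of_join:
  assumes m: "A \<in> \<M>" "B \<in> \<M>" "C \<in> \<M>" and ov: "overlaps A B" "overlaps B C" "overlaps A C"
    and B: "B \<subseteq> set_join \<M> A C"
  shows "middle A B C"
proof -
  have "set_join \<M> A B = A \<union> B" "set_join \<M> C B = C \<union> B" "set_join \<M> A C = A \<union> C"
    using join_eq m ov by (auto simp: overlaps_def)
  moreover have "B = set_join \<M> A B \<inter> set_join \<M> C B"
    using between m ov B by (simp add: overlaps_def)
  ultimately show ?thesis
    using B unfolding middle_def by blast
qed

lemma interval_like: "interval_like \<M>"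
  unfolding interval_like_def
proof (intro conjI ballI impI)
  fix A B assume "A \<in> \<M>" "B \<in> \<M>" "A \<inter> B \<noteq> {}"
  then show "A \<union> B \<in> \<M>"
    using join_upper(1)[of A B] join_eq[of A B] by simp
next
  fix A B C
  assume m: "A \<in> \<M>" "B \<in> \<M>" "C \<in> \<M>" and ov: "overlaps A B \<and> overlaps B C \<and> overlaps A C"
  then have sym: "overlaps B A" "overlaps C B"
    by (auto simp: overlaps_def incomparable_def)
  show "middle A B C \<or> middle B A C \<or> middle A C B"
    using one_below_join[OF m] middle_of_join m ov sym by blast
qed

text \<open>
  The order-free core of the second claim: \<open>shield\<close> expresses that \<open>B\<close>
  lies between \<open>A\<close> and \<open>z\<close>. Whichever of \<open>A\<close>,
  \<open>B\<close>, \<open>N\<close> lies in the join of the other two, the condition on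
  incomparable triples puts \<open>z\<close> into \<open>A\<close> or \<open>B\<close>, or
  \<open>B\<close> into \<open>N\<close>.
\<close>

lemma point_beyond_join:
  assumes ws: "well_separates \<M> X" and m: "A \<in> \<M>" "B \<in> \<M>"
    and disj: "A \<inter> B = {}" "A \<noteq> {}" "B \<noteq> {}"
    and z: "z \<in> set_join \<M> A B" "z \<notin> A" "z \<notin> B"
    and shield: "\<And>M. \<lbrakk>M \<in> \<M>; z \<in> M; A \<inter> M \<noteq> {}\<rbrakk> \<Longrightarrow> B \<subseteq> M"
  shows False
proof -
  have "z \<in> X"
    using z(1) join_upper(1)[OF m] subsets by blast
  then obtain N where N: "N \<in> \<M>" "z \<in> N" "\<not> B \<subseteq> N"
    using ws m(2) disj(3) z(3) unfolding well_separates_def by blast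
  have inc: "incomparable A B" "incomparable A N" "incomparable B N"
    using disj z N shield[OF N(1,2)] unfolding incomparable_def by blast+
  then have inc': "incomparable B A" "incomparable N A" "incomparable N B"
    by (auto simp: incomparable_def)
  have zN: "z \<in> set_join \<M> A N" "z \<in> set_join \<M> B N"
    using join_upper N m by blast+
  consider "A \<subseteq> set_join \<M> B N" | "B \<subseteq> set_join \<M> A N" | "N \<subseteq> set_join \<M> A B"
    using one_below_join m N(1) by blast
  then show False
  proof cases
    case 1
    then have "A = set_join \<M> B A \<inter> set_join \<M> N A"
      using between[of B A N] m N(1) inc inc' by blast
    then show False
      using z zN join_commute[of A B] join_commute[of A N] m N(1) by blast
  next
    case 2
    then have "B = set_join \<M> A B \<inter> set_join \<M> N B"
      using between[of A B N] m N(1) inc inc' by blast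
    then show False
      using z zN join_commute[of B N] m N(1) by blast
  next
    case 3
    then have "N = set_join \<M> A N \<inter> set_join \<M> B N"
      using between[of A N B] m N(1) inc inc' by blast
    moreover have "B \<subseteq> set_join \<M> A N"
      using shield[OF _ zN(1)] join_upper[OF m(1) N(1)] disj(2) by blast
    ultimately show False
      using join_upper(2)[OF m(2) N(1)] N(3) by blast
  qed
qed

end

section \<open>Joins as convex hulls\<close>

lemma order_convex_converse [simp]: "order_convex X (r\<inverse>) C = order_convex X r C"
  unfolding order_convex_def by blast

lemma order_convex_Inter:
  "\<lbrakk>\<C> \<noteq> {}; \<And>C. C \<in> \<C> \<Longrightarrow> order_convex X r C\<rbrakk> \<Longrightarrow> order_convex X r (\<Inter>\<C>)"
  unfolding order_convex_def by blast

lemma order_convex_co: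
  assumes "A \<subseteq> X"
  shows "order_convex X r (co X r A)"
  unfolding co_def hull_def
proof (rule order_convex_Inter)
  have "order_convex X r X"
    by (simp add: order_convex_def)
  then show "{t. order_convex X r t \<and> A \<subseteq> t} \<noteq> {}"
    using assms by blast
qed simp

lemma co_lattice:
  shows "lattice (incl_order (Co X r))"
    and "\<lbrakk>A \<in> Co X r; B \<in> Co X r\<rbrakk> \<Longrightarrow> set_join (Co X r) A B = co X r (A \<union> B)"
    and "\<lbrakk>A \<in> Co X r; B \<in> Co X r\<rbrakk> \<Longrightarrow> set_meet (Co X r) A B = A \<inter> B"
proof -
  interpret partial_order "incl_order (Co X r)"
    by (rule incl_order_partial_order)
  have sup: "least (incl_order (Co X r)) (co X r (A \<union> B)) (Upper (incl_order (Co X r)) {A, B})"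
    if "A \<in> Co X r" "B \<in> Co X r" for A B
  proof (rule least_upperI)
    have "A \<union> B \<subseteq> X"
      using that by (simp add: Co_def order_convex_def)
    then show "co X r (A \<union> B) \<in> Co X r"
      by (simp add: Co_def order_convex_co)
    have "A \<union> B \<subseteq> co X r (A \<union> B)"
      unfolding co_def by (rule hull_subset)
    then show "A \<subseteq> co X r (A \<union> B)" "B \<subseteq> co X r (A \<union> B)"
      by simp_all
    show "co X r (A \<union> B) \<subseteq> C" if "C \<in> Co X r" "A \<subseteq> C" "B \<subseteq> C" for C
      using that unfolding co_def by (intro hull_minimal) (simp_all add: Co_def)
  qed fact+
  have inf: "greatest (incl_order (Co X r)) (A \<inter> B) (Lower (incl_order (Co X r)) {A, B})"
    if "A \<in> Co X r" "B \<in> Co X r" for A B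
  proof (rule greatest_lowerI)
    show "A \<inter> B \<in> Co X r"
      using that order_convex_Inter[of "{A, B}" X r] by (auto simp: Co_def)
  qed fact+
  show "lattice (incl_order (Co X r))"
  proof
    show "\<exists>s. least (incl_order (Co X r)) s (Upper (incl_order (Co X r)) {A, B})"
      if "A \<in> carrier (incl_order (Co X r))" "B \<in> carrier (incl_order (Co X r))" for A B
      using sup that by auto
    show "\<exists>s. greatest (incl_order (Co X r)) s (Lower (incl_order (Co X r)) {A, B})"
      if "A \<in> carrier (incl_order (Co X r))" "B \<in> carrier (incl_order (Co X r))" for A B
      using inf that by auto
  qed
  then interpret lattice "incl_order (Co X r)" .
  show "set_join (Co X r) A B = co X r (A \<union> B)" if "A \<in> Co X r" "B \<in> Co X r"
    using that least_unique[OF _ sup[OF that]] joinI[where P = "\<lambda>l. l = co X r (A \<union> B)"] by simp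
  show "set_meet (Co X r) A B = A \<inter> B" if "A \<in> Co X r" "B \<in> Co X r"
    using that greatest_unique[OF _ inf[OF that]] meetI[where P = "\<lambda>l. l = A \<inter> B"] by simp
qed

text \<open>
  Of two disjoint convex sets, one lies entirely below the other; the upper one then separates the
  lower one from every point above both.
\<close>

lemma disjoint_convex_shield:
  assumes r: "linear_order_on X r" and conv: "order_convex X r A" "order_convex X r B"
    and disj: "A \<inter> B = {}" and below: "\<And>y. y \<in> A \<union> B \<Longrightarrow> (y, z) \<in> r"
  shows "(\<forall>M. order_convex X r M \<longrightarrow> z \<in> M \<longrightarrow> A \<inter> M \<noteq> {} \<longrightarrow> B \<subseteq> M) \<or>
    (\<forall>M. order_convex X r M \<longrightarrow> z \<in> M \<longrightarrow> B \<inter> M \<noteq> {} \<longrightarrow> A \<subseteq> M)"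
proof -
  have sub: "A \<subseteq> X" "B \<subseteq> X"
    using conv by (auto simp: order_convex_def)
  have lin: "(x, y) \<in> r \<or> (y, x) \<in> r" if "x \<in> X" "y \<in> X" for x y
    using r that unfolding order_on_defs total_on_def refl_on_def by metis
  have between: "y \<in> M" if "order_convex X r M" "x \<in> M" "u \<in> M" "(x, y) \<in> r" "(y, u) \<in> r" "y \<in> X"
    for M x y u
    using that unfolding order_convex_def by blast
  have sides: "(\<forall>a\<in>A. \<forall>b\<in>B. (a, b) \<in> r) \<or> (\<forall>a\<in>A. \<forall>b\<in>B. (b, a) \<in> r)"
  proof (rule ccontr)
    assume "\<not> ?thesis"
    then obtain a b a' b' where m: "a \<in> A" "b \<in> B" "a' \<in> A" "b' \<in> B"
      and "(a, b) \<notin> r" "(b', a') \<notin> r"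
      by blast
    then have le: "(b, a) \<in> r" "(a', b') \<in> r"
      using lin sub by blast+
    have "(a, b') \<in> r \<or> (b', a) \<in> r"
      using lin m sub by blast
    then show False
    proof
      assume "(a, b') \<in> r"
      then have "a \<in> B"
        using between[OF conv(2) m(2,4) le(1)] m sub by blast
      then show False using m disj by blast
    next
      assume "(b', a) \<in> r"
      then have "b' \<in> A"
        using between[OF conv(1) m(3,1) le(2)] m sub by blast
      then show False using m disj by blast
    qed
  qed
  then show ?thesis
  proof
    assume ab: "\<forall>a\<in>A. \<forall>b\<in>B. (a, b) \<in> r"
    have "B \<subseteq> M" if "order_convex X r M" "z \<in> M" "A \<inter> M \<noteq> {}" for M
      using between[OF that(1) _ that(2)] that(3) ab below sub by blast
    then show ?thesis by blast
  next
    assume ba: "\<forall>a\<in>A. \<forall>b\<in>B. (b, a) \<in> r"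
    have "A \<subseteq> M" if "order_convex X r M" "z \<in> M" "B \<inter> M \<noteq> {}" for M
      using between[OF that(1) _ that(2)] that(3) ba below sub by blast
    then show ?thesis by blast
  qed
qed

lemma (in loc_lattice) join_eq_co:
  assumes ws: "well_separates \<M> X" and r: "linear_order_on X r"
    and conv: "\<And>M. M \<in> \<M> \<Longrightarrow> order_convex X r M"
    and m: "A \<in> \<M>" "B \<in> \<M>"
  shows "set_join \<M> A B = co X r (A \<union> B)"
proof
  have AB: "A \<union> B \<subseteq> co X r (A \<union> B)"
    unfolding co_def by (rule hull_subset)
  show "co X r (A \<union> B) \<subseteq> set_join \<M> A B"
    unfolding co_def using join_upper[OF m] conv by (intro hull_minimal) simp_all
  show "set_join \<M> A B \<subseteq> co X r (A \<union> B)"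
  proof
    fix z assume z: "z \<in> set_join \<M> A B"
    show "z \<in> co X r (A \<union> B)"
    proof (rule ccontr)
      assume out: "z \<notin> co X r (A \<union> B)"
      have zAB: "z \<notin> A" "z \<notin> B"
        using out AB by auto
      have disj: "A \<inter> B = {}"
        using join_eq[OF m] z zAB by blast
      have ne: "A \<noteq> {}" "B \<noteq> {}"
        using join_least[OF m m(1)] join_least[OF m m(2)] z zAB by blast+
      have zX: "z \<in> X" and ABX: "A \<union> B \<subseteq> X"
        using z join_upper(1)[OF m] m subsets by blast+
      have lin: "(x, y) \<in> r \<or> (y, x) \<in> r" if "x \<in> X" "y \<in> X" for x y
        using r that unfolding order_on_defs total_on_def refl_on_def by metis
      have "\<not> ((x, z) \<in> r \<and> (z, y) \<in> r)" if "x \<in> A \<union> B" "y \<in> A \<union> B" for x y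
        using order_convex_co[OF ABX, of r] out AB that zX unfolding order_convex_def by blast
      then consider "\<forall>y\<in>A \<union> B. (y, z) \<in> r" | "\<forall>y\<in>A \<union> B. (y, z) \<in> r\<inverse>"
        using lin zX ABX by (metis converse_iff subsetD)
      then have "(\<forall>M. order_convex X r M \<longrightarrow> z \<in> M \<longrightarrow> A \<inter> M \<noteq> {} \<longrightarrow> B \<subseteq> M) \<or>
          (\<forall>M. order_convex X r M \<longrightarrow> z \<in> M \<longrightarrow> B \<inter> M \<noteq> {} \<longrightarrow> A \<subseteq> M)"
      proof cases
        case 1
        then show ?thesis
          using disjoint_convex_shield[OF r conv conv disj] m by blast
      next
        case 2
        \<comment> \<open>Reversing the order puts \<open>z\<close> above.\<close>
        then show ?thesis
          using disjoint_convex_shield[of X "r\<inverse>" A B z] r conv m disj by simp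
      qed
      then show False
        using point_beyond_join[OF ws m disj ne z zAB]
          point_beyond_join[OF ws m(2,1) _ ne(2,1) _ zAB(2,1)] conv z disj join_commute[OF m]
        by (metis Int_commute)
    qed
  qed
qed

theorem theorem2p5:
  fixes X :: "'a set" and \<M> :: "'a set set"
  assumes "loc_lattice X \<M>" and "separates \<M> X"
  shows "(\<exists>r. linear_order_on X r \<and> (\<forall>M\<in>\<M>. order_convex X r M)) \<and>
    (well_separates \<M> X \<longrightarrow>
      (\<forall>r. linear_order_on X r \<and> (\<forall>M\<in>\<M>. order_convex X r M) \<longrightarrow>
        (\<forall>A\<in>\<M>. \<forall>B\<in>\<M>. set_join \<M> A B = co X r (A \<union> B)) \<and>
        sublattice_of (incl_order \<M>) (incl_order (Co X r))))"
proof (intro conjI impI allI)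
  interpret loc_lattice X \<M>
    by fact
  obtain r where r: "linear_order_on UNIV r" "\<forall>M\<in>\<M>. order_convex UNIV r M"
    using interval_like_order[OF interval_like] by blast
  have "order_convex X (r \<inter> X \<times> X) M" if "M \<in> \<M>" for M
  proof -
    have "M \<inter> X = M"
      using that subsets by blast
    then show ?thesis
      using order_convex_restrict[of UNIV r M X] r(2) that by simp
  qed
  then show "\<exists>r. linear_order_on X r \<and> (\<forall>M\<in>\<M>. order_convex X r M)"
    using linear_order_on_restrict[OF r(1) subset_UNIV] by blast
next
  interpret loc_lattice X \<M>
    by fact
  fix r assume ws: "well_separates \<M> X"
    and r: "linear_order_on X r \<and> (\<forall>M\<in>\<M>. order_convex X r M)"
  show join: "\<forall>A\<in>\<M>. \<forall>B\<in>\<M>. set_join \<M> A B = co X r (A \<union> B)"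
    using join_eq_co[OF ws] r by blast
  have "\<M> \<subseteq> Co X r"
    using r by (auto simp: Co_def)
  then show "sublattice_of (incl_order \<M>) (incl_order (Co X r))"
    using is_lattice co_lattice(1) join co_lattice(2,3)[of _ X r] meet_eq
    by (simp add: sublattice_of_def subset_eq)
qed

end
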